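(* Let $A$ be a skew left brace and let $(V,\phi)$ be a representation of the group $\Lambda_{A^{\mathrm{op}}}$, i.e. $V$ is a vector space over some field and $\phi:\Lambda_{A^{\mathrm{op}}}\to \mathrm{GL}(V)$ is a group homomorphism. Define $\beta_\phi:(A,\cdot)\to\mathrm{GL}(V)$ and $\rho_\phi:(A,\circ)\to\mathrm{GL}(V)$ by $\beta_\phi(a)=\phi(a,1)$ and $\rho_\phi(b)=\phi(1,b)$ for all $a,b\in A$. Then $(V,\beta_\phi,\rho_\phi)$ is a representation of the skew left brace $A$.
   Context: A skew left brace is a triple $(A,\cdot,\circ)$ where $(A,\cdot)$ and $(A,\circ)$ are groups with $a\circ(b\cdot c)=(a\circ b)\cdot a^{-1}\cdot(a\circ c)$ for all $a,b,c\in A$, where $a^{-1}$ is the inverse in $(A,\cdot)$. We write $ab=a\cdot b$; the two groups share the identity $1$. The map $\lambda^{\mathrm{op}}:(A,\circ)\to\mathrm{Aut}(A,\cdot)$, $\lambda^{\mathrm{op}}_a(b)=(a\circ b)a^{-1}$, is a group homomorphism. The group $\Lambda_{A^{\mathrm{op}}}=(A,\cdot)\rtimes_{\lambda^{\mathrm{op}}}(A,\circ)$ is the set $A\times A$ with product $(a_1,b_1)(a_2,b_2)=(a_1\lambda^{\mathrm{op}}_{b_1}(a_2),\,b_1\circ b_2)$. A representation of a skew left brace $A$ is a triple $(V,\beta,\rho)$ where $V$ is a vector space over some field, $\beta:(A,\cdot)\to\mathrm{GL}(V)$ and $\rho:(A,\circ)\to\mathrm{GL}(V)$ are group homomorphisms,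 and $\beta(\lambda^{\mathrm{op}}_a(b))=\rho(a)\beta(b)\rho(a)^{-1}$ for all $a,b\in A$. *)

theory Defs
  imports "HOL-Algebra.Bij" "HOL-Algebra.Module"
begin

section \<open>Skew left braces\<close>

text \<open>The two group structures are given as two HOL-Algebra groups on the same carrier:
  \<open>A\<close> is the group written multiplicatively in the literature, and \<open>C\<close> is the circle group.
  Their units are not assumed to be equal; this is derived in \<open>circ_one\<close>.\<close>

locale skew_left_brace = group A + circ: group C
  for A :: "('a, 'm) monoid_scheme" (structure) and C :: "('a, 'n) monoid_scheme" +
  assumes carrier_eq: "carrier C = carrier A"
    and brace: "\<lbrakk>a \<in> carrier A; b \<in> carrier A; c \<in> carrier A\<rbrakk> \<Longrightarrow>
      a \<otimes>\<^bsub>C\<^esub> (b \<otimes> c) = (a \<otimes>\<^bsub>C\<^esub> b) \<otimes> inv a \<otimes> (a \<otimes>\<^bsub>C\<^esub> c)"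

text \<open>Restricted to the carrier, because members of \<^const>\<open>AutoGroup\<close> are extensional.\<close>

definition lambda_op ::
  "('a, 'm) monoid_scheme \<Rightarrow> ('a, 'n) monoid_scheme \<Rightarrow> 'a \<Rightarrow> 'a \<Rightarrow> 'a" where
  "lambda_op A C a = (\<lambda>b \<in> carrier A. (a \<otimes>\<^bsub>C\<^esub> b) \<otimes>\<^bsub>A\<^esub> inv\<^bsub>A\<^esub> a)"

definition semidirect_product ::
  "('a, 'm) monoid_scheme \<Rightarrow> ('b, 'n) monoid_scheme \<Rightarrow> ('b \<Rightarrow> 'a \<Rightarrow> 'a) \<Rightarrow> ('a \<times> 'b) monoid" where
  "semidirect_product G H \<theta> =
    \<lparr>carrier = carrier G \<times> carrier H,
     mult = (\<lambda>(a\<^sub>1, b\<^sub>1) (a\<^sub>2, b\<^sub>2). (a\<^sub>1 \<otimes>\<^bsub>G\<^esub> \<theta> b\<^sub>1 a\<^sub>2, b\<^sub>1 \<otimes>\<^bsub>H\<^esub> b\<^sub>2)),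
     one = (\<one>\<^bsub>G\<^esub>, \<one>\<^bsub>H\<^esub>)\<rparr>"

definition Lambda_op ::
  "('a, 'm) monoid_scheme \<Rightarrow> ('a, 'n) monoid_scheme \<Rightarrow> ('a \<times> 'a) monoid" where
  "Lambda_op A C = semidirect_product A C (lambda_op A C)"


section \<open>Representations\<close>

locale vectorspace = K: field K + module K V
  for K :: "('k, 'm) ring_scheme" and V :: "('k, 'v, 'n) module_scheme"

text \<open>As for \<^const>\<open>AutoGroup\<close>, the linear automorphisms are taken to be extensional functions
  on the carrier of \<open>V\<close>, and the group operations are those of \<^const>\<open>BijGroup\<close>.\<close>

definition GL :: "('k, 'm) ring_scheme \<Rightarrow> ('k, 'v, 'n) module_scheme \<Rightarrow> ('v \<Rightarrow> 'v) monoid" where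
  "GL K V = BijGroup (carrier V)
    \<lparr>carrier := {f \<in> Bij (carrier V).
       (\<forall>x \<in> carrier V. \<forall>y \<in> carrier V. f (x \<oplus>\<^bsub>V\<^esub> y) = f x \<oplus>\<^bsub>V\<^esub> f y) \<and>
       (\<forall>r \<in> carrier K. \<forall>x \<in> carrier V. f (r \<odot>\<^bsub>V\<^esub> x) = r \<odot>\<^bsub>V\<^esub> f x)}\<rparr>"

locale group_representation = group G + vectorspace K V
  for G :: "('g, 'l) monoid_scheme"
    and K :: "('k, 'm) ring_scheme" and V :: "('k, 'v, 'n) module_scheme" +
  fixes \<phi> :: "'g \<Rightarrow> 'v \<Rightarrow> 'v"
  assumes hom: "\<phi> \<in> hom G (GL K V)"

locale brace_representation = skew_left_brace A C + vectorspace K V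
  for A :: "('a, 'p) monoid_scheme" and C :: "('a, 'q) monoid_scheme"
    and K :: "('k, 'm) ring_scheme" and V :: "('k, 'v, 'n) module_scheme" +
  fixes \<beta> \<rho> :: "'a \<Rightarrow> 'v \<Rightarrow> 'v"
  assumes beta_hom: "\<beta> \<in> hom A (GL K V)"
    and rho_hom: "\<rho> \<in> hom C (GL K V)"
    and compat: "\<lbrakk>a \<in> carrier A; b \<in> carrier A\<rbrakk> \<Longrightarrow>
      \<beta> (lambda_op A C a b) = \<rho> a \<otimes>\<^bsub>GL K V\<^esub> \<beta> b \<otimes>\<^bsub>GL K V\<^esub> inv\<^bsub>GL K V\<^esub> (\<rho> a)"


section \<open>The structures above are groups\<close>

lemma (in vectorspace) group_GL: "group (GL K V)"
proof -
  let ?L = "carrier (GL K V)"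
  have L: "f \<in> ?L \<longleftrightarrow> f \<in> Bij (carrier V) \<and>
       (\<forall>x \<in> carrier V. \<forall>y \<in> carrier V. f (x \<oplus>\<^bsub>V\<^esub> y) = f x \<oplus>\<^bsub>V\<^esub> f y) \<and>
       (\<forall>r \<in> carrier K. \<forall>x \<in> carrier V. f (r \<odot>\<^bsub>V\<^esub> x) = r \<odot>\<^bsub>V\<^esub> f x)" for f
    by (simp add: GL_def)
  have cl: "f x \<in> carrier V" if "f \<in> Bij (carrier V)" "x \<in> carrier V" for f x
    using that Bij_imp_funcset by fastforce
  have "subgroup ?L (BijGroup (carrier V))"
  proof (rule subgroup.intro)
    show "?L \<subseteq> carrier (BijGroup (carrier V))"
      by (auto simp: L BijGroup_def)
    show "f \<otimes>\<^bsub>BijGroup (carrier V)\<^esub> g \<in> ?L" if "f \<in> ?L" "g \<in> ?L" for f g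
      using that unfolding L by (auto simp: BijGroup_def compose_Bij compose_eq cl)
    show "\<one>\<^bsub>BijGroup (carrier V)\<^esub> \<in> ?L"
      unfolding L by (auto simp: BijGroup_def id_Bij)
    show "inv\<^bsub>BijGroup (carrier V)\<^esub> f \<in> ?L" if f: "f \<in> ?L" for f
    proof -
      let ?h = "inv_into (carrier V) f"
      have B: "f \<in> Bij (carrier V)" using f L by blast
      then have im: "f ` carrier V = carrier V" and inj: "inj_on f (carrier V)"
        by (auto simp: Bij_def bij_betw_def)
      have h: "?h x \<in> carrier V" "f (?h x) = x" if "x \<in> carrier V" for x
        using that im by (auto intro: inv_into_into f_inv_into_f)
      have "?h (x \<oplus>\<^bsub>V\<^esub> y) = ?h x \<oplus>\<^bsub>V\<^esub> ?h y" if "x \<in> carrier V" "y \<in> carrier V" for x y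
        using that h f inj by (intro inv_into_f_eq) (auto simp: L)
      moreover have "?h (r \<odot>\<^bsub>V\<^esub> x) = r \<odot>\<^bsub>V\<^esub> ?h x" if "r \<in> carrier K" "x \<in> carrier V" for r x
        using that h f inj by (intro inv_into_f_eq) (auto simp: L)
      ultimately show ?thesis
        unfolding L inv_BijGroup[OF B] using restrict_inv_into_Bij[OF B] by auto
    qed
  qed
  then have "group (BijGroup (carrier V) \<lparr>carrier := ?L\<rparr>)"
    using group_BijGroup subgroup.subgroup_is_group by blast
  then show ?thesis by (simp add: GL_def)
qed

lemma group_semidirect_product:
  assumes "group G" "group H" and \<theta>: "\<theta> \<in> hom H (AutoGroup G)"
  shows "group (semidirect_product G H \<theta>)"
proof -
  interpret G: group G by fact
  interpret H: group H by fact
  interpret AutG: group "AutoGroup G" by (rule G.AutoGroup)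
  interpret \<theta>: group_hom H "AutoGroup G" \<theta>
    using \<theta> by (simp add: group_hom_def group_hom_axioms_def H.is_group AutG.is_group)
  have aut: "\<theta> b \<in> hom G G" "\<theta> b \<in> Bij (carrier G)" if "b \<in> carrier H" for b
    using \<theta>.hom_closed[OF that] by (auto simp: AutoGroup_def auto_def)
  have cl: "\<theta> b a \<in> carrier G" if "b \<in> carrier H" "a \<in> carrier G" for a b
    using aut(1)[OF that(1)] that(2) by (rule hom_in_carrier)
  have mult: "\<theta> b (a \<otimes>\<^bsub>G\<^esub> a') = \<theta> b a \<otimes>\<^bsub>G\<^esub> \<theta> b a'"
    if "b \<in> carrier H" "a \<in> carrier G" "a' \<in> carrier G" for a a' b
    using aut(1)[OF that(1)] that(2,3) by (rule hom_mult)
  have comp: "\<theta> (b \<otimes>\<^bsub>H\<^esub> b') a = \<theta> b (\<theta> b' a)"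
    if "b \<in> carrier H" "b' \<in> carrier H" "a \<in> carrier G" for a b b'
    using \<theta>.hom_mult[OF that(1,2)] that aut
    by (simp add: AutoGroup_def BijGroup_def compose_eq)
  have one: "\<theta> \<one>\<^bsub>H\<^esub> a = a" if "a \<in> carrier G" for a
    using \<theta>.hom_one that by (simp add: AutoGroup_def BijGroup_def)
  show ?thesis
  proof (rule groupI, goal_cases)
    case (5 x)
    then obtain a b where x: "x = (a, b)" "a \<in> carrier G" "b \<in> carrier H"
      by (auto simp: semidirect_product_def)
    let ?y = "(\<theta> (inv\<^bsub>H\<^esub> b) (inv\<^bsub>G\<^esub> a), inv\<^bsub>H\<^esub> b)"
    have "\<theta> (inv\<^bsub>H\<^esub> b) (inv\<^bsub>G\<^esub> a) \<otimes>\<^bsub>G\<^esub> \<theta> (inv\<^bsub>H\<^esub> b) a = \<theta> (inv\<^bsub>H\<^esub> b) \<one>\<^bsub>G\<^esub>"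
      using x by (simp del: \<theta>.hom_inv flip: mult)
    also have "\<dots> = \<one>\<^bsub>G\<^esub>"
      using x aut(1)[of "inv\<^bsub>H\<^esub> b"] by (simp add: hom_one G.is_group del: \<theta>.hom_inv)
    finally show ?case
      using x by (intro bexI[of _ ?y]) (auto simp: semidirect_product_def cl simp del: \<theta>.hom_inv)
  qed (auto simp: semidirect_product_def cl mult comp one G.m_assoc H.m_assoc
        simp del: \<theta>.hom_mult \<theta>.hom_one)
qed

context skew_left_brace
begin

lemma circ_closed [simp]:
  "a \<in> carrier A \<Longrightarrow> b \<in> carrier A \<Longrightarrow> a \<otimes>\<^bsub>C\<^esub> b \<in> carrier A"
  using circ.m_closed by (simp add: carrier_eq)

lemma circ_one: "\<one>\<^bsub>C\<^esub> = \<one>"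
proof -
  let ?e = "\<one>\<^bsub>C\<^esub>"
  have e: "?e \<in> carrier A" using circ.one_closed by (simp add: carrier_eq)
  have "\<one> = ?e \<otimes>\<^bsub>C\<^esub> (\<one> \<otimes> \<one>)" by (simp add: carrier_eq)
  also have "\<dots> = \<one> \<otimes> inv ?e \<otimes> \<one>" using brace[OF e, of \<one> \<one>] by (simp add: carrier_eq)
  finally have "inv ?e = \<one>" using e by simp
  then show ?thesis using e by (metis inv_inv inv_one)
qed

lemma lambda_op_hom: "lambda_op A C \<in> hom C (AutoGroup A)"
proof -
  let ?l = "lambda_op A C"
  have ap: "?l a b = (a \<otimes>\<^bsub>C\<^esub> b) \<otimes> inv a" if "b \<in> carrier A" for a b
    using that by (simp add: lambda_op_def)
  have cl: "?l a b \<in> carrier A" if "a \<in> carrier A" "b \<in> carrier A" for a b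
    using that by (simp add: ap)
  have hom: "?l a \<in> hom A A" if "a \<in> carrier A" for a
    using that by (auto simp: hom_def ap brace m_assoc)
  have comp: "?l (a \<otimes>\<^bsub>C\<^esub> b) c = ?l a (?l b c)"
    if abc: "a \<in> carrier A" "b \<in> carrier A" "c \<in> carrier A" for a b c
  proof -
    interpret l: group_hom A A "?l a"
      using hom[OF abc(1)] by (simp add: group_hom_def group_hom_axioms_def is_group)
    have "?l a (?l b c) = ?l a (b \<otimes>\<^bsub>C\<^esub> c) \<otimes> inv (?l a b)"
      using abc by (simp add: ap[of c b])
    also have "\<dots> = (a \<otimes>\<^bsub>C\<^esub> (b \<otimes>\<^bsub>C\<^esub> c)) \<otimes> inv a \<otimes> (a \<otimes> inv (a \<otimes>\<^bsub>C\<^esub> b))"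
      using abc by (simp add: ap inv_mult_group)
    also have "\<dots> = (a \<otimes>\<^bsub>C\<^esub> (b \<otimes>\<^bsub>C\<^esub> c)) \<otimes> inv (a \<otimes>\<^bsub>C\<^esub> b)"
      using abc by (simp add: m_assoc inv_solve_left')
    finally show ?thesis
      using abc circ.m_assoc[of a b c] by (simp add: ap carrier_eq)
  qed
  have one: "?l \<one>\<^bsub>C\<^esub> c = c" if "c \<in> carrier A" for c
    using that circ.l_one[of c] by (simp add: ap carrier_eq circ_one)
  have Bij: "?l a \<in> Bij (carrier A)" if a: "a \<in> carrier A" for a
  proof -
    let ?a' = "inv\<^bsub>C\<^esub> a"
    have a': "?a' \<in> carrier A" using a circ.inv_closed[of a] by (simp add: carrier_eq)
    have "bij_betw (?l a) (carrier A) (carrier A)"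
      by (rule bij_betw_byWitness[where f' = "?l ?a'"])
        (use a a' one circ.l_inv[of a] circ.r_inv[of a] in
          \<open>auto simp: cl carrier_eq simp flip: comp\<close>)
    then show ?thesis by (simp add: Bij_def lambda_op_def)
  qed
  show ?thesis
  proof (rule homI)
    show "?l a \<in> carrier (AutoGroup A)" if "a \<in> carrier C" for a
      using that hom Bij by (simp add: AutoGroup_def auto_def carrier_eq)
    show "?l (a \<otimes>\<^bsub>C\<^esub> b) = ?l a \<otimes>\<^bsub>AutoGroup A\<^esub> ?l b"
      if "a \<in> carrier C" "b \<in> carrier C" for a b
    proof
      fix x
      show "?l (a \<otimes>\<^bsub>C\<^esub> b) x = (?l a \<otimes>\<^bsub>AutoGroup A\<^esub> ?l b) x"
        using that Bij comp
        by (cases "x \<in> carrier A")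
          (simp_all add: AutoGroup_def BijGroup_def carrier_eq compose_def lambda_op_def)
    qed
  qed
qed

lemma group_Lambda_op: "group (Lambda_op A C)"
  unfolding Lambda_op_def
  by (intro group_semidirect_product lambda_op_hom is_group circ.is_group)

end

end

theory Submission
  imports Defs
begin

text \<open>In the semidirect product \<open>(\<theta> b a, 1) (1, b) = (\<theta> b a, b) = (1, b) (a, 1)\<close>, so \<open>\<theta>\<close> is
  conjugation by the second factor; applying \<open>\<phi>\<close> gives the compatibility condition.\<close>

text \<open>The unit of \<open>AutoGroup G\<close> is the identity restricted to the carrier, so
  evaluation at the unit of \<open>H\<close> is controlled only for \<open>a\<close> in
  \<open>carrier G\<close>.\<close>

lemma AutoGroup_hom_one_apply:
  assumes "group G" "group H" "\<theta> \<in> hom H (AutoGroup G)" "a \<in> carrier G"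
  shows "\<theta> \<one>\<^bsub>H\<^esub> a = a"
  using hom_one[OF assms(3) assms(2) group.AutoGroup[OF assms(1)]] assms(4)
  by (simp add: AutoGroup_def BijGroup_def)

lemma AutoGroup_hom_apply_hom:
  assumes "\<theta> \<in> hom H (AutoGroup G)" "b \<in> carrier H"
  shows "\<theta> b \<in> hom G G"
  using hom_in_carrier[OF assms] by (simp add: AutoGroup_def auto_def)

text \<open>The twist is invisible on the first factor: it acts there through the unit of
  \<open>H\<close>, that is, trivially.\<close>

lemma semidirect_product_inl_hom:
  assumes "group G" "group H" "\<theta> \<in> hom H (AutoGroup G)"
  shows "(\<lambda>a. (a, \<one>\<^bsub>H\<^esub>)) \<in> hom G (semidirect_product G H \<theta>)"
proof -
  interpret G: group G by fact
  interpret H: group H by fact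
  show ?thesis
    by (auto simp: hom_def semidirect_product_def AutoGroup_hom_one_apply[OF assms])
qed

text \<open>Here the twist is applied only to the unit of \<open>G\<close>, which every automorphism
  fixes.\<close>

lemma semidirect_product_inr_hom:
  assumes "group G" "group H" "\<theta> \<in> hom H (AutoGroup G)"
  shows "(\<lambda>b. (\<one>\<^bsub>G\<^esub>, b)) \<in> hom H (semidirect_product G H \<theta>)"
proof -
  interpret G: group G by fact
  interpret H: group H by fact
  have "\<theta> b \<one>\<^bsub>G\<^esub> = \<one>\<^bsub>G\<^esub>" if "b \<in> carrier H" for b
    using hom_one[OF AutoGroup_hom_apply_hom[OF assms(3) that] assms(1,1)] .
  then show ?thesis
    by (auto simp: hom_def semidirect_product_def)
qed

text \<open>Conjugation is stated without inverses, so that a homomorphism carries it over by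
  multiplicativity alone.\<close>

lemma semidirect_product_inr_inl_commute:
  assumes "group G" "group H" "\<theta> \<in> hom H (AutoGroup G)"
    and "a \<in> carrier G" "b \<in> carrier H"
  shows "(\<theta> b a, \<one>\<^bsub>H\<^esub>) \<otimes>\<^bsub>semidirect_product G H \<theta>\<^esub> (\<one>\<^bsub>G\<^esub>, b)
    = (\<one>\<^bsub>G\<^esub>, b) \<otimes>\<^bsub>semidirect_product G H \<theta>\<^esub> (a, \<one>\<^bsub>H\<^esub>)"
proof -
  interpret G: group G by fact
  interpret H: group H by fact
  have "\<theta> b a \<in> carrier G"
    using hom_in_carrier[OF AutoGroup_hom_apply_hom[OF assms(3,5)] assms(4)] .
  then show ?thesis
    using assms(5) by (simp add: semidirect_product_def AutoGroup_hom_one_apply[OF assms(1-3)])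
qed

theorem theorem4p5:
  fixes A :: "('a, 'p) monoid_scheme" and C :: "('a, 'q) monoid_scheme"
    and K :: "('k, 'm) ring_scheme" and V :: "('k, 'v, 'n) module_scheme"
    and \<phi> :: "'a \<times> 'a \<Rightarrow> 'v \<Rightarrow> 'v"
    and \<beta>\<^sub>\<phi> \<rho>\<^sub>\<phi> :: "'a \<Rightarrow> 'v \<Rightarrow> 'v"
  assumes "skew_left_brace A C"
    and "group_representation (Lambda_op A C) K V \<phi>"
    and "\<And>a. a \<in> carrier A \<Longrightarrow> \<beta>\<^sub>\<phi> a = \<phi> (a, \<one>\<^bsub>C\<^esub>)"
    and "\<And>b. b \<in> carrier A \<Longrightarrow> \<rho>\<^sub>\<phi> b = \<phi> (\<one>\<^bsub>A\<^esub>, b)"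
  shows "brace_representation A C K V \<beta>\<^sub>\<phi> \<rho>\<^sub>\<phi>"
proof -
  interpret skew_left_brace A C by fact
  interpret R: group_representation "Lambda_op A C" K V \<phi> by fact
  interpret GL: group "GL K V" by (rule R.group_GL)
  note groups = is_group circ.is_group lambda_op_hom
  note inl = semidirect_product_inl_hom[OF groups, folded Lambda_op_def]
    and inr = semidirect_product_inr_hom[OF groups, folded Lambda_op_def]
  \<comment> \<open>\<open>\<beta>\<^sub>\<phi>\<close> is prescribed only on the carrier. It agrees
    there with \<open>\<phi>\<close> after the embedding, and membership in \<open>hom\<close>
    depends only on those values.\<close>
  have \<beta>: "\<beta>\<^sub>\<phi> \<in> hom A (GL K V)"
    using Group.hom_compose[OF inl R.hom] assms(3) by (auto simp: hom_def Pi_def)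
  have \<rho>: "\<rho>\<^sub>\<phi> \<in> hom C (GL K V)"
    using Group.hom_compose[OF inr R.hom] assms(4) by (auto simp: hom_def Pi_def carrier_eq)
  have "\<beta>\<^sub>\<phi> (lambda_op A C a b) = \<rho>\<^sub>\<phi> a \<otimes>\<^bsub>GL K V\<^esub> \<beta>\<^sub>\<phi> b \<otimes>\<^bsub>GL K V\<^esub> inv\<^bsub>GL K V\<^esub> (\<rho>\<^sub>\<phi> a)"
    if a: "a \<in> carrier A" and b: "b \<in> carrier A" for a b
  proof -
    have aC: "a \<in> carrier C" using a by (simp add: carrier_eq)
    \<comment> \<open>Closure allows \<open>\<beta>\<^sub>\<phi>\<close> to be rewritten through
      \<open>\<phi>\<close> at this argument.\<close>
    have l: "lambda_op A C a b \<in> carrier A"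
      using hom_in_carrier[OF AutoGroup_hom_apply_hom[OF lambda_op_hom aC] b] .
    have cl: "\<beta>\<^sub>\<phi> b \<in> carrier (GL K V)" "\<beta>\<^sub>\<phi> (lambda_op A C a b) \<in> carrier (GL K V)"
      "\<rho>\<^sub>\<phi> a \<in> carrier (GL K V)"
      using hom_in_carrier[OF \<beta>] hom_in_carrier[OF \<rho>] aC b l by blast+
    \<comment> \<open>Reversed multiplicativity of \<open>\<phi>\<close> merges each side into the
      image of one product in \<open>Lambda_op A C\<close>; the commutation rule equates the two
      products.\<close>
    have "\<beta>\<^sub>\<phi> (lambda_op A C a b) \<otimes>\<^bsub>GL K V\<^esub> \<rho>\<^sub>\<phi> a = \<rho>\<^sub>\<phi> a \<otimes>\<^bsub>GL K V\<^esub> \<beta>\<^sub>\<phi> b"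
      using semidirect_product_inr_inl_commute[OF groups b aC, folded Lambda_op_def]
        hom_in_carrier[OF inl] hom_in_carrier[OF inr] a aC b l
      by (simp add: assms(3,4) flip: hom_mult[OF R.hom])
    \<comment> \<open>Right multiplication by the inverse of \<open>\<rho>\<^sub>\<phi> a\<close> in
      the group \<open>GL K V\<close> turns commutation into conjugation.\<close>
    then show ?thesis
      using cl by (metis GL.inv_solve_right GL.m_closed)
  qed
  with \<beta> \<rho> show ?thesis
    by unfold_locales auto
qed

end
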